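(* Let $\Omega$ be a convex subset of a Banach space $\mathbb{X}$ and let $(a_n)_{n \in \mathbb{N}}$, $(b_n)_{n \in \mathbb{N}}$ be two sequences in $[0,1]$. Assume that $T_1 \in \mathbf{Ne}_{\alpha_1}(\Omega)$, $T_2 \in \mathbf{Ne}_{\alpha_2}(\Omega)$ have a common fixed point $x^* \in \mathcal{F}(T_1, T_2)$ for some $\alpha_1, \alpha_2 \in [0,1]$ satisfying $0<\alpha_1+\alpha_2<2$. Let $(x_n)_{n \in \mathbb{N}}$ be the iterative sequence defined by an initial point $x_0\in\Omega$ and $$x_{n+1} = (1-b_n)x_n + b_nT_2\big((1-a_n)x_n + a_nT_1(x_n)\big),\quad n\in\mathbb{N}.$$ Then $(x_n)$ converges to $x^*$ as $n\to\infty$ if one of the two following assumptions is satisfied: (i) $\alpha_1 \in [0,1]$, $\alpha_2<1$ and $\sum_{k=0}^{\infty} b_k = +\infty$; (ii) $\alpha_1 \in [0,1)$, $\alpha_2=1$ and $\sum_{k=0}^{\infty} a_kb_k = +\infty$. In particular, if $\alpha_2<1$ and $1-b_k - \alpha_2 b_k(1 - a_k + \alpha_1a_k) > 0$ for every $k \in \mathbb{N}$, then $$\lim_{n \to \infty} x_n = x^* \iff \sum_{k=0}^{\infty} b_k = +\infty.$$ Moreover, when $\alpha_2<1$ and $\sum_{k=0}^{\infty} b_k = +\infty$, one has $$\log \mathcal{R}^{-1}(x_{n+1},x_0,x^* ) \approx \sum_{k=0}^n b_k,$$ if there exists $\varepsilon \in (0,1)$ such that $$b_k \le \frac{1-\varepsilon}{1+\alpha_2(1-a_k+\alpha_1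 a_k)} \quad \text{for every } k \in \mathbb{N}.$$
   Context: Banach spaces are real; $\mathbb{N}=\{0,1,2,\dots\}$. For $\alpha\in[0,1]$, $\mathbf{Ne}_{\alpha}(\Omega)$ is the set of maps $T:\Omega\to\Omega$ with $\|T(x)-T(y)\|\le\alpha\|x-y\|$ for all $x,y\in\Omega$. $\mathcal{F}(T_1,T_2)$ is the set of common fixed points, i.e. of $x^*\in\Omega$ with $T_1(x^* )=T_2(x^* )=x^*$. For $u,x,p\in\mathbb{X}$, $\mathcal{R}(u,x,p):=\|u-p\|/\|x-p\|$ if $x\neq p$; $\mathcal{R}(u,x,p):=1$ if $u\neq x=p$; $\mathcal{R}(u,x,p):=0$ if $u=x=p$. $\mathcal{R}^{-1}$ denotes the reciprocal $1/\mathcal{R}$. For real sequences, $u_n\approx v_n$ means that there exist constants $c_1,c_2>0$ not depending on $n$ such that $c_1u_n\le v_n\le c_2u_n$ for every $n\in\mathbb{N}$.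
   Formalization: The equivalence and the logarithmic rate are stated under the extra assumption x_0 ≠ x*; if x_0 = x* the sequence is constant, so the equivalence fails (e.g. b_k = 0) and log R^{-1} is undefined since R = 0. *)

theory Defs
  imports "HOL-Analysis.Analysis"
begin

text \<open>Self-maps of \<open>\<Omega>\<close> are total functions whose values outside \<open>\<Omega>\<close> are irrelevant.\<close>

definition Ne :: "real \<Rightarrow> 'a::real_normed_vector set \<Rightarrow> ('a \<Rightarrow> 'a) set" where
  "Ne \<alpha> \<Omega> = {T. T \<in> \<Omega> \<rightarrow> \<Omega> \<and> (\<forall>x\<in>\<Omega>. \<forall>y\<in>\<Omega>. norm (T x - T y) \<le> \<alpha> * norm (x - y))}"

definition common_fixed_points :: "'a set \<Rightarrow> ('a \<Rightarrow> 'a) \<Rightarrow> ('a \<Rightarrow> 'a) \<Rightarrow> 'a set" where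
  "common_fixed_points \<Omega> T1 T2 = {p \<in> \<Omega>. T1 p = p \<and> T2 p = p}"

definition error_ratio :: "'a::real_normed_vector \<Rightarrow> 'a \<Rightarrow> 'a \<Rightarrow> real" where
  "error_ratio u x p =
     (if x \<noteq> p then norm (u - p) / norm (x - p)
      else if u \<noteq> x then 1
      else 0)"

text \<open>Two-sided comparison for every index, not merely eventually.\<close>

definition comparable :: "(nat \<Rightarrow> real) \<Rightarrow> (nat \<Rightarrow> real) \<Rightarrow> bool" where
  "comparable u v \<longleftrightarrow> (\<exists>c1>0. \<exists>c2>0. \<forall>n. c1 * u n \<le> v n \<and> v n \<le> c2 * u n)"

definition series_diverges :: "(nat \<Rightarrow> real) \<Rightarrow> bool" where
  "series_diverges f \<longleftrightarrow> filterlim (\<lambda>n. \<Sum>k\<le>n. f k) at_top sequentially"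

end

theory Submission
  imports Defs
begin

text \<open>Put \<open>q k = 1 - a k + \<alpha>1 * a k\<close> and \<open>d k = norm (x k - xs)\<close>. The triangle inequality gives
  \<open>(1 - b k - \<alpha>2 * b k * q k) * d k \<le> d (Suc k) \<le> (1 - b k + \<alpha>2 * b k * q k) * d k\<close>.
  The upper factor is compared with an exponential through \<open>1 - t \<le> exp (- t)\<close>, the lower one
  through \<open>exp (- t / \<epsilon>) \<le> 1 - t\<close>, valid for \<open>0 \<le> t \<le> 1 - \<epsilon>\<close>.\<close>

lemma exp_neg_divide_le_one_minus:
  fixes t \<epsilon> :: real
  assumes "0 < \<epsilon>" "0 \<le> t" "t \<le> 1 - \<epsilon>"
  shows "exp (- (t / \<epsilon>)) \<le> 1 - t"
proof -
  have pos: "0 < 1 - t"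
    using assms by simp
  \<comment> \<open>Passing to reciprocals turns the claim into an upper bound for
    \<open>1 / (1 - t)\<close>; since \<open>1 - t \<ge> \<epsilon>\<close>, the remainder
    \<open>t / (1 - t)\<close> is at most \<open>t / \<epsilon>\<close>.\<close>
  have "1 / (1 - t) = 1 + t / (1 - t)"
    using pos by (simp add: field_simps)
  also have "\<dots> \<le> 1 + t / \<epsilon>"
    using assms by (simp add: frac_le)
  also have "\<dots> \<le> exp (t / \<epsilon>)"
    by (rule exp_ge_add_one_self)
  finally have "1 / (1 - t) \<le> exp (t / \<epsilon>)" .
  then have "1 \<le> exp (t / \<epsilon>) * (1 - t)"
    using pos by (simp add: pos_divide_le_eq)
  then show ?thesis
    by (simp add: exp_minus inverse_eq_divide pos_divide_le_eq mult.commute)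
qed

lemma decay_upper_bound:
  fixes d c :: "nat \<Rightarrow> real"
  assumes "\<And>k. 0 \<le> d k" "\<And>k. d (Suc k) \<le> (1 - c k) * d k"
  shows "d n \<le> d 0 * exp (- (\<Sum>k<n. c k))"
proof (induction n)
  case (Suc n)
  have "d (Suc n) \<le> exp (- c n) * d n"
    using assms(2)[of n] mult_right_mono[OF _ assms(1)[of n], of "1 - c n" "exp (- c n)"]
      exp_ge_add_one_self[of "- c n"] by simp
  also have "\<dots> \<le> exp (- c n) * (d 0 * exp (- (\<Sum>k<n. c k)))"
    using Suc.IH by simp
  finally show ?case
    by (simp add: exp_diff exp_minus field_simps)
qed simp

text \<open>The uniform gap \<open>\<epsilon>\<close> between \<open>c k\<close> and 1 costs only a
  factor \<open>1 / \<epsilon>\<close> in the exponent at each step. This serves both the rate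
  estimate and, applied to tails, the summable case.\<close>

lemma decay_lower_bound:
  fixes d c :: "nat \<Rightarrow> real"
  assumes "\<And>k. 0 \<le> d k" "\<And>k. (1 - c k) * d k \<le> d (Suc k)"
    and "0 < \<epsilon>" "\<And>k. 0 \<le> c k" "\<And>k. c k \<le> 1 - \<epsilon>"
  shows "d 0 * exp (- ((\<Sum>k<n. c k) / \<epsilon>)) \<le> d n"
proof (induction n)
  case (Suc n)
  have "d 0 * exp (- ((\<Sum>k<Suc n. c k) / \<epsilon>)) = exp (- (c n / \<epsilon>)) * (d 0 * exp (- ((\<Sum>k<n. c k) / \<epsilon>)))"
    by (simp add: add_divide_distrib exp_diff exp_minus field_simps)
  also have "\<dots> \<le> exp (- (c n / \<epsilon>)) * d n"
    using Suc.IH by simp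
  also have "\<dots> \<le> (1 - c n) * d n"
    by (intro mult_right_mono exp_neg_divide_le_one_minus assms)
  also have "\<dots> \<le> d (Suc n)"
    by (rule assms(2))
  finally show ?case .
qed simp

text \<open>Partial sums of nonnegative terms increase, so they are either bounded, hence
  convergent, or tend to infinity.\<close>

lemma series_diverges_iff_not_summable:
  fixes f :: "nat \<Rightarrow> real"
  assumes "\<And>k. 0 \<le> f k"
  shows "series_diverges f \<longleftrightarrow> \<not> summable f"
proof
  assume "series_diverges f"
  then have lim: "filterlim (\<lambda>n. \<Sum>k\<le>n. f k) at_top sequentially"
    by (simp add: series_diverges_def)
  show "\<not> summable f"
  proof
    assume "summable f"
    then have "(\<lambda>n. \<Sum>k\<le>n. f k) \<longlonglongrightarrow> suminf f"
      by (rule summable_LIMSEQ')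
    then show False
      using not_tendsto_and_filterlim_at_infinity[OF sequentially_bot]
        filterlim_at_top_imp_at_infinity[OF lim] by blast
  qed
next
  assume ns: "\<not> summable f"
  show "series_diverges f"
    unfolding series_diverges_def filterlim_at_top
  proof
    fix Z :: real
    have "\<not> (\<forall>N. (\<Sum>k\<le>N. f k) \<le> Z)"
    proof
      assume "\<forall>N. (\<Sum>k\<le>N. f k) \<le> Z"
      then have "summable f"
        by (intro bounded_imp_summable[where a = f and B = Z] assms) (rule spec)
      with ns show False
        by contradiction
    qed
    then obtain N where N: "Z < (\<Sum>k\<le>N. f k)"
      unfolding not_all not_le by (rule exE)
    have "Z \<le> (\<Sum>k\<le>n. f k)" if "n \<ge> N" for n
      by (rule order_trans[OF less_imp_le[OF N] sum_mono2]) (use assms that in simp_all)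
    then show "\<forall>\<^sub>F n in sequentially. Z \<le> (\<Sum>k\<le>n. f k)"
      unfolding eventually_sequentially by blast
  qed
qed

lemma series_diverges_cmult:
  assumes "series_diverges f" "0 < r"
  shows "series_diverges (\<lambda>k. r * f k)"
  using assms unfolding series_diverges_def sum_distrib_left[symmetric]
  by (intro filterlim_tendsto_pos_mult_at_top[OF tendsto_const])

lemma decay_tendsto_zero:
  fixes d c :: "nat \<Rightarrow> real"
  assumes "\<And>k. 0 \<le> d k" "\<And>k. d (Suc k) \<le> (1 - c k) * d k" "series_diverges c"
  shows "d \<longlonglongrightarrow> 0"
proof -
  \<comment> \<open>The bound on \<open>d n\<close> involves only the first \<open>n\<close>
    factors, whereas \<open>series_diverges\<close> sums up to and including \<open>n\<close>; the
    shift by one does not affect the limit.\<close>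
  have "filterlim (\<lambda>n. \<Sum>k<n. c k) at_top sequentially"
    using assms(3) unfolding series_diverges_def lessThan_Suc_atMost[symmetric]
    by (rule filterlim_sequentially_Suc[THEN iffD1])
  then have "(\<lambda>n. exp (- (\<Sum>k<n. c k))) \<longlonglongrightarrow> 0"
    by (intro filterlim_compose[OF exp_at_bot] filterlim_compose[OF filterlim_uminus_at_bot_at_top])
  then have "(\<lambda>n. d 0 * exp (- (\<Sum>k<n. c k))) \<longlonglongrightarrow> 0"
    by (rule tendsto_mult_right_zero)
  then show ?thesis
    by (rule tendsto_sandwich[OF always_eventually always_eventually tendsto_const, rotated 2])
      (use assms(1) decay_upper_bound[of d c, OF assms(1,2)] in blast)+
qed

text \<open>Although \<open>c k < 1\<close> gives no uniform gap, a summable \<open>c\<close> tends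
  to 0, so a gap of 1/2 is available from some index \<open>N\<close> on. The strict inequality
  keeps \<open>d N\<close> positive, and the tail then stays above a fixed positive multiple of
  \<open>d N\<close>.\<close>

lemma summable_decay_not_tendsto_zero:
  fixes d c :: "nat \<Rightarrow> real"
  assumes "0 < d 0" "\<And>k. (1 - c k) * d k \<le> d (Suc k)"
    and "\<And>k. 0 \<le> c k" "\<And>k. c k < 1" "summable c"
  shows "\<not> d \<longlonglongrightarrow> 0"
proof
  assume lim: "d \<longlonglongrightarrow> 0"
  have pos: "0 < d k" for k
  proof (induction k)
    case (Suc k)
    then have "0 < (1 - c k) * d k"
      using assms(4) by simp
    then show ?case
      using assms(2) by (rule less_le_trans)
  qed (rule assms(1))
  have "\<forall>\<^sub>F k in sequentially. c k < 1 / 2"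
    using summable_LIMSEQ_zero[OF assms(5)] by (rule order_tendstoD) simp
  then obtain N where N: "\<And>k. k \<ge> N \<Longrightarrow> c k < 1 / 2"
    by (auto simp: eventually_sequentially)
  \<comment> \<open>The full tail sum bounds all its partial sums, which makes the lower bound
    independent of \<open>n\<close>; the divisor \<open>1 / 2\<close> below is the gap in
    \<open>decay_lower_bound\<close>.\<close>
  define s where "s = (\<Sum>k. c (k + N))"
  have "d N * exp (- (s / (1 / 2))) \<le> d (n + N)" for n
  proof -
    have "(\<Sum>k<n. c (k + N)) \<le> s"
      unfolding s_def using assms(3,5) by (intro sum_le_suminf) simp_all
    then have "d N * exp (- (s / (1 / 2))) \<le> d N * exp (- ((\<Sum>k<n. c (k + N)) / (1 / 2)))"
      using pos by simp
    also have "\<dots> \<le> d (n + N)"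
      using decay_lower_bound[of "\<lambda>k. d (k + N)" "\<lambda>k. c (k + N)" "1 / 2" n]
        assms(2,3) N pos by (simp add: less_imp_le)
    finally show ?thesis .
  qed
  then have "d N * exp (- (s / (1 / 2))) \<le> 0"
    by (intro LIMSEQ_le_const[OF LIMSEQ_ignore_initial_segment[OF lim]]) auto
  then show False
    using pos[of N] by (simp add: mult_le_0_iff)
qed

lemma Ne_fixed_point_bound:
  assumes "T \<in> Ne \<alpha> \<Omega>" "x \<in> \<Omega>"
  shows "T x \<in> \<Omega>"
    and "p \<in> \<Omega> \<Longrightarrow> T p = p \<Longrightarrow> norm (T x - p) \<le> \<alpha> * norm (x - p)"
  using assms unfolding Ne_def by (blast, metis (lifting) mem_Collect_eq)

text \<open>The inner average multiplies the distance to \<open>p\<close> by at most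
  \<open>1 - a + \<alpha>1 * a\<close>, and \<open>T2\<close> by at most \<open>\<alpha>2\<close>,
  so \<open>e\<close> bounds the share of the \<open>T2\<close> term. Convexity keeps both averages
  in \<open>\<Omega>\<close>, where these estimates apply.\<close>

lemma two_step_error_bounds:
  fixes x p :: "'a::real_normed_vector"
  assumes "convex \<Omega>" "a \<in> {0..1}" "b \<in> {0..1}" "0 \<le> \<alpha>2"
    and "T1 \<in> Ne \<alpha>1 \<Omega>" "T2 \<in> Ne \<alpha>2 \<Omega>" "p \<in> common_fixed_points \<Omega> T1 T2" "x \<in> \<Omega>"
  defines "z \<equiv> (1 - b) *\<^sub>R x + b *\<^sub>R T2 ((1 - a) *\<^sub>R x + a *\<^sub>R T1 x)"
  defines "e \<equiv> \<alpha>2 * b * (1 - a + \<alpha>1 * a)"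
  shows "z \<in> \<Omega>"
    and "norm (z - p) \<le> (1 - b + e) * norm (x - p)"
    and "(1 - b - e) * norm (x - p) \<le> norm (z - p)"
proof -
  define y where "y = (1 - a) *\<^sub>R x + a *\<^sub>R T1 x"
  have p: "p \<in> \<Omega>" "T1 p = p" "T2 p = p"
    using assms(7) by (auto simp: common_fixed_points_def)
  have T1x: "T1 x \<in> \<Omega>" "norm (T1 x - p) \<le> \<alpha>1 * norm (x - p)"
    using Ne_fixed_point_bound[OF assms(5,8)] p by auto
  have y: "y \<in> \<Omega>"
    unfolding y_def using assms T1x by (intro convexD) auto
  have T2y: "T2 y \<in> \<Omega>" "norm (T2 y - p) \<le> \<alpha>2 * norm (y - p)"
    using Ne_fixed_point_bound[OF assms(6) y] p by auto
  show "z \<in> \<Omega>"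
    unfolding z_def y_def[symmetric] using assms T2y by (intro convexD) auto
  have "norm (y - p) = norm ((1 - a) *\<^sub>R (x - p) + a *\<^sub>R (T1 x - p))"
    by (simp add: y_def algebra_simps)
  also have "\<dots> \<le> (1 - a) * norm (x - p) + a * norm (T1 x - p)"
    using assms(2) by (intro norm_triangle_le) simp
  also have "\<dots> \<le> (1 - a) * norm (x - p) + a * (\<alpha>1 * norm (x - p))"
    using assms(2) T1x by (intro add_left_mono mult_left_mono) auto
  finally have ny: "norm (y - p) \<le> (1 - a + \<alpha>1 * a) * norm (x - p)"
    by (simp add: algebra_simps)
  have "b * norm (T2 y - p) \<le> b * (\<alpha>2 * ((1 - a + \<alpha>1 * a) * norm (x - p)))"
    using assms(3,4) T2y ny by (intro mult_left_mono order_trans[OF T2y(2)]) auto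
  then have bT: "norm (b *\<^sub>R (T2 y - p)) \<le> e * norm (x - p)"
    using assms(3) by (simp add: e_def mult_ac)
  have b: "norm ((1 - b) *\<^sub>R (x - p)) = (1 - b) * norm (x - p)"
    using assms(3) by simp
  \<comment> \<open>One decomposition gives both bounds, by the triangle inequality and by its
    reverse.\<close>
  have z: "z - p = (1 - b) *\<^sub>R (x - p) + b *\<^sub>R (T2 y - p)"
    by (simp add: z_def y_def algebra_simps)
  show "norm (z - p) \<le> (1 - b + e) * norm (x - p)"
    using norm_triangle_ineq[of "(1 - b) *\<^sub>R (x - p)" "b *\<^sub>R (T2 y - p)"] b bT
    unfolding z distrib_right by linarith
  show "(1 - b - e) * norm (x - p) \<le> norm (z - p)"
    using norm_diff_ineq[of "(1 - b) *\<^sub>R (x - p)" "b *\<^sub>R (T2 y - p)"] b bT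
    unfolding z left_diff_distrib by linarith
qed

theorem theorem4p1:
  fixes \<Omega> :: "'a::banach set"
    and a b :: "nat \<Rightarrow> real"
    and \<alpha>1 \<alpha>2 :: real
    and T1 T2 :: "'a \<Rightarrow> 'a"
    and x :: "nat \<Rightarrow> 'a"
    and xs :: 'a
  assumes "convex \<Omega>"
    and "\<forall>n. a n \<in> {0..1}"
    and "\<forall>n. b n \<in> {0..1}"
    and "\<alpha>1 \<in> {0..1}" and "\<alpha>2 \<in> {0..1}"
    and "0 < \<alpha>1 + \<alpha>2" and "\<alpha>1 + \<alpha>2 < 2"
    and "T1 \<in> Ne \<alpha>1 \<Omega>" and "T2 \<in> Ne \<alpha>2 \<Omega>"
    and "xs \<in> common_fixed_points \<Omega> T1 T2"
    and "x 0 \<in> \<Omega>"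
    and "\<forall>n. x (Suc n) =
           (1 - b n) *\<^sub>R x n + b n *\<^sub>R T2 ((1 - a n) *\<^sub>R x n + a n *\<^sub>R T1 (x n))"
  shows "((\<alpha>2 < 1 \<and> series_diverges b) \<or>
          (\<alpha>1 < 1 \<and> \<alpha>2 = 1 \<and> series_diverges (\<lambda>k. a k * b k))
            \<longrightarrow> x \<longlonglongrightarrow> xs)
       \<and> (x 0 \<noteq> xs \<and> \<alpha>2 < 1 \<and>
          (\<forall>k. 1 - b k - \<alpha>2 * b k * (1 - a k + \<alpha>1 * a k) > 0)
            \<longrightarrow> (x \<longlonglongrightarrow> xs \<longleftrightarrow> series_diverges b))
       \<and> (x 0 \<noteq> xs \<and> \<alpha>2 < 1 \<and> series_diverges b \<and>
          (\<exists>\<epsilon>. 0 < \<epsilon> \<and> \<epsilon> < 1 \<and>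
             (\<forall>k. b k \<le> (1 - \<epsilon>) / (1 + \<alpha>2 * (1 - a k + \<alpha>1 * a k))))
            \<longrightarrow> comparable (\<lambda>n. ln (1 / error_ratio (x (Suc n)) (x 0) xs))
                           (\<lambda>n. \<Sum>k\<le>n. b k))"
proof -
  define d where "d = (\<lambda>k. norm (x k - xs))"
  define q where "q = (\<lambda>k. 1 - a k + \<alpha>1 * a k)"
  \<comment> \<open>Chosen so that \<open>1 - c k\<close> is the lower factor: the positivity
    condition becomes \<open>c k < 1\<close>, and the condition with \<open>\<epsilon>\<close>
    becomes \<open>c k \<le> 1 - \<epsilon>\<close>.\<close>
  define c where "c = (\<lambda>k. b k * (1 + \<alpha>2 * q k))"
  have a: "0 \<le> a k" "a k \<le> 1" and b: "0 \<le> b k" "b k \<le> 1" for k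
    using assms(2,3) by auto
  have \<alpha>: "0 \<le> \<alpha>1" "\<alpha>1 \<le> 1" "0 \<le> \<alpha>2" "\<alpha>2 \<le> 1"
    using assms(4,5) by auto
  have x_Suc: "x (Suc k) = (1 - b k) *\<^sub>R x k + b k *\<^sub>R T2 ((1 - a k) *\<^sub>R x k + a k *\<^sub>R T1 (x k))" for k
    using assms(12) by blast
  note step = two_step_error_bounds[where x = "x k" and a = "a k" and b = "b k" for k,
      OF assms(1) assms(2)[THEN spec] assms(3)[THEN spec] \<alpha>(3) assms(8-10), folded x_Suc]
  have x_in: "x k \<in> \<Omega>" for k
    by (induction k) (use assms(11) step(1) in auto)
  have d_nonneg: "0 \<le> d k" for k
    by (simp add: d_def)
  have d_upper: "d (Suc k) \<le> (1 - b k + \<alpha>2 * b k * q k) * d k" for k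
    using step(2)[OF x_in] by (simp add: d_def q_def)
  have d_lower: "(1 - c k) * d k \<le> d (Suc k)" for k
    using step(3)[OF x_in, of k] by (simp add: d_def q_def c_def algebra_simps)
  have q: "0 \<le> q k" "q k \<le> 1" for k
    using a[of k] \<alpha> mult_right_mono[of \<alpha>1 1 "a k"] by (auto simp: q_def)
  have \<alpha>2q: "0 \<le> \<alpha>2 * q k" "\<alpha>2 * q k \<le> \<alpha>2" "\<alpha>2 * q k \<le> 1" for k
    using q[of k] \<alpha> by (auto simp: mult_left_le mult_le_one)
  have c_nonneg: "0 \<le> c k" for k
    using b \<alpha>2q by (simp add: c_def)
  have c_le: "c k \<le> 2 * b k" for k
    using b[of k] \<alpha>2q[of k] mult_left_mono[of "1 + \<alpha>2 * q k" 2 "b k"] by (simp add: c_def)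
  \<comment> \<open>Using only \<open>q k \<le> 1\<close> leaves a decay rate proportional to
    \<open>b k\<close>, which is positive for \<open>\<alpha>2 < 1\<close> and
    \<open>b k > 0\<close>.\<close>
  have d_upper1: "d (Suc k) \<le> (1 - (1 - \<alpha>2) * b k) * d k" for k
  proof -
    have "b k * (\<alpha>2 * q k) \<le> b k * \<alpha>2"
      using b \<alpha>2q by (intro mult_left_mono)
    then have "1 - b k + \<alpha>2 * b k * q k \<le> 1 - (1 - \<alpha>2) * b k"
      by (simp add: algebra_simps)
    from mult_right_mono[OF this d_nonneg] d_upper show ?thesis
      by (rule order_trans[rotated])
  qed
  have x_iff: "x \<longlonglongrightarrow> xs \<longleftrightarrow> d \<longlonglongrightarrow> 0"
    unfolding d_def by (simp add: LIM_zero_iff tendsto_norm_zero_iff)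
  have conv1: "x \<longlonglongrightarrow> xs" if "\<alpha>2 < 1" "series_diverges b"
    unfolding x_iff using that
    by (intro decay_tendsto_zero[where d = d, OF d_nonneg d_upper1] series_diverges_cmult) auto
  \<comment> \<open>For \<open>\<alpha>2 = 1\<close> the contraction comes from \<open>T1\<close>
    alone: the upper factor is exactly \<open>1 - (1 - \<alpha>1) * (a k * b k)\<close>.\<close>
  have conv2: "x \<longlonglongrightarrow> xs" if "\<alpha>1 < 1" "\<alpha>2 = 1" "series_diverges (\<lambda>k. a k * b k)"
    unfolding x_iff
  proof (rule decay_tendsto_zero[where d = d, OF d_nonneg])
    show "d (Suc k) \<le> (1 - (1 - \<alpha>1) * (a k * b k)) * d k" for k
      using d_upper[of k] that(2) by (simp add: q_def algebra_simps)
    show "series_diverges (\<lambda>k. (1 - \<alpha>1) * (a k * b k))"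
      using that by (intro series_diverges_cmult) auto
  qed
  \<comment> \<open>Starting away from \<open>xs\<close> matters: from \<open>xs\<close> itself the
    iterates never move, so they converge whatever \<open>b\<close> is.\<close>
  have conv_iff: "x \<longlonglongrightarrow> xs \<longleftrightarrow> series_diverges b"
    if "x 0 \<noteq> xs" "\<alpha>2 < 1" "\<forall>k. 1 - b k - \<alpha>2 * b k * (1 - a k + \<alpha>1 * a k) > 0"
  proof
    show "x \<longlonglongrightarrow> xs" if "series_diverges b"
      using conv1 \<open>\<alpha>2 < 1\<close> that by blast
    have c_less: "c k < 1" for k
      using that(3)[rule_format, of k] by (simp add: c_def q_def algebra_simps)
    have d0: "0 < d 0"
      using that(1) by (simp add: d_def)
    assume lim: "x \<longlonglongrightarrow> xs"
    show "series_diverges b"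
    \<comment> \<open>If \<open>b\<close> were summable, \<open>c k \<le> 2 * b k\<close> would make
      \<open>c\<close> summable too, and the errors could not tend to 0.\<close>
    proof (rule ccontr)
      assume "\<not> series_diverges b"
      then have "summable (\<lambda>k. 2 * b k)"
        using series_diverges_iff_not_summable[of b] b by (intro summable_mult) auto
      then have "summable c"
        using c_le c_nonneg by (intro summable_comparison_test'[of "\<lambda>k. 2 * b k" 0 c]) auto
      then show False
        using summable_decay_not_tendsto_zero[where d = d, OF d0 d_lower c_nonneg c_less] lim x_iff by blast
    qed
  qed
  have rate: "comparable (\<lambda>n. ln (1 / error_ratio (x (Suc n)) (x 0) xs)) (\<lambda>n. \<Sum>k\<le>n. b k)"
    if "x 0 \<noteq> xs" "\<alpha>2 < 1" "0 < \<epsilon>"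
      and b_le: "\<And>k. b k \<le> (1 - \<epsilon>) / (1 + \<alpha>2 * (1 - a k + \<alpha>1 * a k))" for \<epsilon>
  proof -
    define R where "R = (\<lambda>n. ln (1 / error_ratio (x (Suc n)) (x 0) xs))"
    define B where "B = (\<lambda>n. \<Sum>k\<le>n. b k)"
    have d0: "0 < d 0"
      using that(1) by (simp add: d_def)
    have c_le': "c k \<le> 1 - \<epsilon>" for k
      using b_le[of k] \<alpha>2q(1)[of k] by (simp add: c_def q_def pos_le_divide_eq)
    have lower: "d 0 * exp (- ((\<Sum>k<n. c k) / \<epsilon>)) \<le> d n" for n
      by (rule decay_lower_bound[where d = d, OF d_nonneg d_lower \<open>0 < \<epsilon>\<close> c_nonneg c_le'])
    \<comment> \<open>Positivity ensures that the quotients and logarithms below are genuine, not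
      the default values of division by 0 or of \<open>ln 0\<close>.\<close>
    have d_pos: "0 < d n" for n
      using lower[of n] d0 by (smt (verit) exp_gt_zero mult_pos_pos)
    have R: "R n = ln (d 0 / d (Suc n))" for n
      using that(1) by (simp add: R_def error_ratio_def d_def)
    have "(1 - \<alpha>2) * B n \<le> R n" for n
    proof -
      \<comment> \<open>Reaching \<open>x (Suc n)\<close> takes the steps \<open>0..n\<close>, hence
        the bound at \<open>Suc n\<close> contains the sum over \<open>k \<le> n\<close>.\<close>
      have "d (Suc n) \<le> d 0 * exp (- ((1 - \<alpha>2) * B n))"
        using decay_upper_bound[where d = d, OF d_nonneg d_upper1, of "Suc n"]
        by (simp only: B_def sum_distrib_left lessThan_Suc_atMost)
      then have "exp ((1 - \<alpha>2) * B n) \<le> d 0 / d (Suc n)"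
        using d_pos[of "Suc n"] unfolding exp_minus
        by (simp add: pos_le_divide_eq divide_inverse[symmetric] mult.commute)
      then show ?thesis
        using d0 d_pos by (simp add: R ln_ge_iff)
    qed
    moreover have "R n \<le> 2 / \<epsilon> * B n" for n
    proof -
      have "d 0 * exp (- ((\<Sum>k\<le>n. c k) / \<epsilon>)) \<le> d (Suc n)"
        using lower[of "Suc n"] by (simp only: lessThan_Suc_atMost)
      then have "d 0 / d (Suc n) \<le> exp ((\<Sum>k\<le>n. c k) / \<epsilon>)"
        using d_pos[of "Suc n"] by (simp add: exp_minus field_simps)
      then have "R n \<le> (\<Sum>k\<le>n. c k) / \<epsilon>"
        using d0 d_pos[of "Suc n"] ln_mono[of "d 0 / d (Suc n)" "exp ((\<Sum>k\<le>n. c k) / \<epsilon>)"]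
        by (simp add: R)
      also have "\<dots> \<le> 2 / \<epsilon> * B n"
        using sum_mono[of "{..n}" c "\<lambda>k. 2 * b k"] c_le \<open>0 < \<epsilon>\<close>
        by (simp add: B_def sum_distrib_left[symmetric] divide_right_mono)
      finally show ?thesis .
    qed
    \<comment> \<open>Inverting
      \<open>(1 - \<alpha>2) * B n \<le> R n \<le> 2 / \<epsilon> * B n\<close> yields the two
      comparison constants, which do not depend on \<open>n\<close>.\<close>
    ultimately have "\<epsilon> / 2 * R n \<le> B n \<and> B n \<le> 1 / (1 - \<alpha>2) * R n" for n
      using \<open>0 < \<epsilon>\<close> \<open>\<alpha>2 < 1\<close> by (simp add: field_simps)
    moreover have "0 < \<epsilon> / 2" "0 < 1 / (1 - \<alpha>2)"
      using \<open>0 < \<epsilon>\<close> \<open>\<alpha>2 < 1\<close> by simp_all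
    ultimately have "comparable R B"
      unfolding comparable_def by blast
    then show ?thesis
      by (simp only: R_def B_def)
  qed
  show ?thesis
    using conv1 conv2 conv_iff rate by blast
qed

end
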